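(* Let $h(\mathbf{X},\{\boldsymbol{\Gamma}_i\})=\sum_{k=1}^{K}\omega_k\Bigl(\log\det(\mathbf{I}+\boldsymbol{\Gamma}_k)-\mathrm{tr}(\boldsymbol{\Gamma}_k)+\mathrm{tr}\bigl((\mathbf{I}+\boldsymbol{\Gamma}_k)\sqrt{\mathbf{C}}_k^{\mathsf{H}}(\mathbf{X})(\mathbf{C}_k(\mathbf{X})+\mathbf{D}_k(\mathbf{X}))^{-1}\sqrt{\mathbf{C}}_k(\mathbf{X})\bigr)\Bigr)$ be the objective of the Lagrangian-dual-transformed problem, and let $F(\mathbf{X})=\sum_{k=1}^{K}\omega_k\log\det\bigl(\mathbf{I}+\sqrt{\mathbf{C}}_k^{\mathsf{H}}(\mathbf{X})\mathbf{D}_k^{-1}(\mathbf{X})\sqrt{\mathbf{C}}_k(\mathbf{X})\bigr)$ be the original objective on $\mathcal{X}$. Then updating $\{\boldsymbol{\Gamma}_i\}$ in the transformed problem by block coordinate ascent amounts to constructing the log-det surrogate of $F$. Precisely: fix $\underline{\mathbf{X}}\in\mathcal{X}$ and let $\{\underline{\boldsymbol{\Gamma}}_i\}$ be the maximizer of $h(\underline{\mathbf{X}},\{\boldsymbol{\Gamma}_i\})$ over $\{\boldsymbol{\Gamma}_i\}$. Then for every $\mathbf{X}\in\mathcal{X}$, $$h(\mathbf{X},\{\underline{\boldsymbol{\Gamma}}_i\})=\sum_{k=1}^{K}\omega_k\Bigl(\log\det(\mathbf{Z}_k(\underline{\mathbf{X}}))+\mathrm{tr}\bigl(\mathbf{I}-\mathbf{Z}_k(\underline{\mathbf{X}})\,\mathbf{Z}_k(\mathbf{X})^{-1}\bigr)\Bigr),\qquad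 \mathbf{Z}_k(\mathbf{X})=\mathbf{I}+\sqrt{\mathbf{C}}_k^{\mathsf{H}}(\mathbf{X})\mathbf{D}_k^{-1}(\mathbf{X})\sqrt{\mathbf{C}}_k(\mathbf{X}),$$ which is the surrogate function of $F$ at $\underline{\mathbf{X}}$ obtained by applying, to each $\log\det(\mathbf{Z}_k(\mathbf{X}))$, the lower bound $\log\det(\mathbf{Z})\ge\log\det(\underline{\mathbf{Z}})+\mathrm{tr}(\mathbf{I}-\underline{\mathbf{Z}}\mathbf{Z}^{-1})$ (valid for $\mathbf{Z},\underline{\mathbf{Z}}\succ\mathbf{0}$, with equality at $\mathbf{Z}=\underline{\mathbf{Z}}$).
   Context: $\mathcal{X}$ is a set (of matrices); for $k=1,\dots,K$, $\omega_k>0$ are weights. For $\mathbf{X}\in\mathcal{X}$, $\mathbf{C}_k(\mathbf{X})\succeq\mathbf{0}$ and $\mathbf{D}_k(\mathbf{X})\succ\mathbf{0}$ are Hermitian complex matrices of equal size $n_k\times n_k$, and $\sqrt{\mathbf{C}}_k(\mathbf{X})$ is an $n_k\times m_k$ matrix factor with $\sqrt{\mathbf{C}}_k(\mathbf{X})\sqrt{\mathbf{C}}_k^{\mathsf{H}}(\mathbf{X})=\mathbf{C}_k(\mathbf{X})$. The variables $\boldsymbol{\Gamma}_k$ range over Hermitian $m_k\times m_k$ matrices with $\mathbf{I}+\boldsymbol{\Gamma}_k\succ\mathbf{0}$. $\succeq$ ($\succ$) denotes positive semidefinite (definite) order, $(\cdot)^{\mathsf H}$ conjugate transpose, $\log$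 the natural logarithm. Block coordinate ascent updates one block of variables by maximizing the objective over that block with the other blocks fixed at their current values (current value of $\mathbf{X}$: $\underline{\mathbf{X}}$). A surrogate function of $F:\mathcal{X}\to\mathbb{R}$ at $\underline{\mathbf{X}}$ is a function $\ell(\cdot,\underline{\mathbf{X}})$ on $\mathcal{X}$ with $\ell(\mathbf{X},\underline{\mathbf{X}})\le F(\mathbf{X})$ for all $\mathbf{X}\in\mathcal{X}$ and $\ell(\underline{\mathbf{X}},\underline{\mathbf{X}})=F(\underline{\mathbf{X}})$. *)

theory Defs
  imports
    Complex_Main
    "HOL-Library.FuncSet"
    "Jordan_Normal_Form.Gauss_Jordan_Elimination"
    "Jordan_Normal_Form.Schur_Decomposition"
begin

definition hermitian_mat :: "complex mat \<Rightarrow> bool" where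
  "hermitian_mat A \<longleftrightarrow> mat_adjoint A = A"

text \<open>
  The order on \<^typ>\<open>complex\<close> makes \<open>0 \<le> z\<close> (\<open>0 < z\<close>) mean that \<open>z\<close> is real and nonnegative
  (positive). The term \<open>(A *\<^sub>v v) \<bullet>c v\<close> is the quadratic form \<open>v\<^sup>H A v\<close>.
\<close>

definition pos_semidef_mat :: "complex mat \<Rightarrow> bool" where
  "pos_semidef_mat A \<longleftrightarrow> hermitian_mat A \<and>
     (\<forall>v \<in> carrier_vec (dim_row A). 0 \<le> (A *\<^sub>v v) \<bullet>c v)"

definition pos_def_mat :: "complex mat \<Rightarrow> bool" where
  "pos_def_mat A \<longleftrightarrow> hermitian_mat A \<and>
     (\<forall>v \<in> carrier_vec (dim_row A). v \<noteq> 0\<^sub>v (dim_row A) \<longrightarrow> 0 < (A *\<^sub>v v) \<bullet>c v)"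

text \<open>Only meaningful for invertible square matrices.\<close>

definition mat_inv :: "complex mat \<Rightarrow> complex mat" where
  "mat_inv A = the (mat_inverse A)"

definition mat_trace :: "complex mat \<Rightarrow> complex" where
  "mat_trace A = (\<Sum>i<dim_row A. A $$ (i, i))"

text \<open>
  The argument is always positive definite where this is used, so that its determinant is real
  and positive. Likewise, real parts of traces are taken below only to obtain a real number: the
  traces concerned are those of Hermitian matrices or of products of two Hermitian matrices, which
  are real.
\<close>

definition log_det :: "complex mat \<Rightarrow> real" where
  "log_det A = ln (Re (det A))"

definition log_det_bound :: "complex mat \<Rightarrow> complex mat \<Rightarrow> real" where
  "log_det_bound Z0 Z =
     log_det Z0 + Re (mat_trace (1\<^sub>m (dim_row Z) - Z0 * mat_inv Z))"

text \<open>
  In the following, \<open>m k\<close> is the number of columns of the factor \<open>R k X\<close> of \<open>C k X\<close>, that is,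
  \<open>R k X * mat_adjoint (R k X) = C k X\<close>.
\<close>

definition Z_mat :: "(nat \<Rightarrow> nat) \<Rightarrow> (nat \<Rightarrow> 'x \<Rightarrow> complex mat) \<Rightarrow> (nat \<Rightarrow> 'x \<Rightarrow> complex mat) \<Rightarrow>
    nat \<Rightarrow> 'x \<Rightarrow> complex mat" where
  "Z_mat m R D k X = 1\<^sub>m (m k) + mat_adjoint (R k X) * mat_inv (D k X) * R k X"

definition original_objective :: "nat \<Rightarrow> (nat \<Rightarrow> real) \<Rightarrow> (nat \<Rightarrow> nat) \<Rightarrow>
    (nat \<Rightarrow> 'x \<Rightarrow> complex mat) \<Rightarrow> (nat \<Rightarrow> 'x \<Rightarrow> complex mat) \<Rightarrow> 'x \<Rightarrow> real" where
  "original_objective K \<omega> m R D X = (\<Sum>k = 1..K. \<omega> k * log_det (Z_mat m R D k X))"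

definition dual_objective :: "nat \<Rightarrow> (nat \<Rightarrow> real) \<Rightarrow> (nat \<Rightarrow> nat) \<Rightarrow>
    (nat \<Rightarrow> 'x \<Rightarrow> complex mat) \<Rightarrow> (nat \<Rightarrow> 'x \<Rightarrow> complex mat) \<Rightarrow> (nat \<Rightarrow> 'x \<Rightarrow> complex mat) \<Rightarrow>
    'x \<Rightarrow> (nat \<Rightarrow> complex mat) \<Rightarrow> real" where
  "dual_objective K \<omega> m C R D X \<Gamma> =
     (\<Sum>k = 1..K. \<omega> k *
        (log_det (1\<^sub>m (m k) + \<Gamma> k) - Re (mat_trace (\<Gamma> k)) +
         Re (mat_trace ((1\<^sub>m (m k) + \<Gamma> k) * mat_adjoint (R k X) *
                        mat_inv (C k X + D k X) * R k X))))"

text \<open>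
  Families indexed by \<open>{1..K}\<close> are extensional functions, so that they are determined by their
  values on \<open>{1..K}\<close> and uniqueness of a maximizer can be expressed.
\<close>

definition dual_feasible :: "nat \<Rightarrow> (nat \<Rightarrow> nat) \<Rightarrow> (nat \<Rightarrow> complex mat) set" where
  "dual_feasible K m =
     (\<Pi>\<^sub>E k \<in> {1..K}. {G \<in> carrier_mat (m k) (m k). hermitian_mat G \<and> pos_def_mat (1\<^sub>m (m k) + G)})"

definition surrogate_at :: "'x set \<Rightarrow> ('x \<Rightarrow> real) \<Rightarrow> 'x \<Rightarrow> ('x \<Rightarrow> real) \<Rightarrow> bool" where
  "surrogate_at \<X> F X0 l \<longleftrightarrow> (\<forall>X \<in> \<X>. l X \<le> F X) \<and> l X0 = F X0"

end

theory Submission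
  imports Defs
begin

text \<open>
  With \<open>W = C + D\<close> and \<open>C = R R\<^sup>H\<close>, the Woodbury identity gives \<open>Z\<^sup>-\<^sup>1 = I - R\<^sup>H W\<^sup>-\<^sup>1 R\<close>, which turns the
  \<open>k\<close>-th summand of the transformed objective into the log-det bound with \<open>I + \<Gamma>\<^sub>k\<close> in place of the
  reference matrix. That bound never exceeds \<open>log det Z\<close>, with equality only if \<open>I + \<Gamma>\<^sub>k = Z\<close>, so the
  unique maximizer at the current point is \<open>\<Gamma>\<^sub>k = Z - I\<close>. Writing \<open>Z = T T\<^sup>H\<close> (Cholesky) reduces the
  bound to \<open>log det M \<le> tr (M - I)\<close> for \<open>M = T\<^sup>-\<^sup>1 S T\<^sup>-\<^sup>H\<close>, and a Cholesky factor \<open>L\<close> of \<open>M\<close> reduces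
  that to \<open>ln x \<le> x - 1\<close> at the \<open>L\<^sub>i\<^sub>i\<^sup>2\<close>, since \<open>tr M\<close> is the sum of all \<open>|L\<^sub>i\<^sub>j|\<^sup>2\<close>.
\<close>

section \<open>Adjoints\<close>

lemma mat_adjoint_dim [simp]:
  "dim_row (mat_adjoint A) = dim_col A" "dim_col (mat_adjoint A) = dim_row A"
  by (simp_all add: mat_adjoint_def)

lemma mat_adjoint_carrier [simp]: "A \<in> carrier_mat r c \<Longrightarrow> mat_adjoint A \<in> carrier_mat c r"
  by (auto intro: carrier_matI)

lemma mat_adjoint_index [simp]:
  fixes A :: "'a :: conjugatable_field mat"
  shows "i < dim_col A \<Longrightarrow> j < dim_row A \<Longrightarrow> mat_adjoint A $$ (i, j) = conjugate (A $$ (j, i))"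
  by (simp add: mat_adjoint_def mat_of_rows_index)

lemma mat_adjoint_adjoint [simp]: "mat_adjoint (mat_adjoint A) = A"
  by (rule eq_matI) auto

lemma mat_adjoint_one [simp]: "mat_adjoint (1\<^sub>m r) = (1\<^sub>m r :: complex mat)"
  by (rule eq_matI) auto

lemma mat_adjoint_add:
  "A \<in> carrier_mat r c \<Longrightarrow> B \<in> carrier_mat r c \<Longrightarrow>
     mat_adjoint (A + B) = mat_adjoint A + mat_adjoint B"
  by (rule eq_matI) (auto simp: conjugate_dist_add)

lemma mat_adjoint_diff:
  fixes A :: "complex mat"
  shows "A \<in> carrier_mat r c \<Longrightarrow> B \<in> carrier_mat r c \<Longrightarrow>
     mat_adjoint (A - B) = mat_adjoint A - mat_adjoint B"
  by (rule eq_matI) auto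

lemma mat_adjoint_mult:
  fixes A :: "'a :: conjugatable_field mat"
  assumes "A \<in> carrier_mat r s" "B \<in> carrier_mat s c"
  shows "mat_adjoint (A * B) = mat_adjoint B * mat_adjoint A"
  by (rule eq_matI)
    (use assms in \<open>auto simp: scalar_prod_def sum_conjugate conjugate_dist_mul mult.commute\<close>)

text \<open>The adjoint is the transpose of the entrywise conjugate, and conjugation is a ring
  homomorphism, so it commutes with the determinant.\<close>

lemma det_mat_adjoint:
  fixes A :: "complex mat"
  assumes "A \<in> carrier_mat r r"
  shows "det (mat_adjoint A) = cnj (det A)"
proof -
  interpret cnj: comm_ring_hom cnj by unfold_locales auto
  have "mat_adjoint A = transpose_mat (map_mat cnj A)"
    by (rule eq_matI) auto
  then show ?thesis
    using assms by (simp add: det_transpose[of _ r])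
qed

text \<open>This moves a factor across the inner product; congruences and Gram matrices are reduced
  to simpler quadratic forms by it.\<close>

lemma cscalar_prod_adjoint:
  fixes A :: "complex mat"
  assumes A: "A \<in> carrier_mat r c" and v: "v \<in> carrier_vec c" and w: "w \<in> carrier_vec r"
  shows "(A *\<^sub>v v) \<bullet>c w = v \<bullet>c (mat_adjoint A *\<^sub>v w)"
proof -
  have "(A *\<^sub>v v) \<bullet>c w = (\<Sum>i<r. \<Sum>j<c. A $$ (i, j) * v $ j * cnj (w $ i))"
    using assms by (simp add: scalar_prod_def sum_distrib_right atLeast0LessThan)
  also have "\<dots> = (\<Sum>j<c. \<Sum>i<r. A $$ (i, j) * v $ j * cnj (w $ i))"
    by (rule sum.swap)
  also have "\<dots> = v \<bullet>c (mat_adjoint A *\<^sub>v w)"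
    using assms by (simp add: scalar_prod_def sum_distrib_left atLeast0LessThan mult_ac)
  finally show ?thesis .
qed

section \<open>Positive definite matrices\<close>

lemma pos_def_matD:
  assumes "pos_def_mat A" "A \<in> carrier_mat r r"
  shows "mat_adjoint A = A"
    and "v \<in> carrier_vec r \<Longrightarrow> v \<noteq> 0\<^sub>v r \<Longrightarrow> 0 < (A *\<^sub>v v) \<bullet>c v"
  using assms by (auto simp: pos_def_mat_def hermitian_mat_def)

lemma pos_def_matI:
  assumes "A \<in> carrier_mat r r" "mat_adjoint A = A"
    and "\<And>v. v \<in> carrier_vec r \<Longrightarrow> v \<noteq> 0\<^sub>v r \<Longrightarrow> 0 < (A *\<^sub>v v) \<bullet>c v"
  shows "pos_def_mat A"
  using assms by (auto simp: pos_def_mat_def hermitian_mat_def)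

section \<open>Inverses and congruence\<close>

lemma mat_inv_inverse:
  assumes A: "A \<in> carrier_mat r r" and "det A \<noteq> 0"
  shows "mat_inv A \<in> carrier_mat r r" "A * mat_inv A = 1\<^sub>m r" "mat_inv A * A = 1\<^sub>m r"
proof -
  \<comment> \<open>The last argument of \<open>ring_mat\<close> only fills the extension slot of
    the ring record, so any value serves.\<close>
  have "A \<in> Units (ring_mat TYPE(complex) r undefined)"
    using assms by (rule det_non_zero_imp_unit)
  then obtain B where B: "mat_inverse A = Some B"
    using mat_inverse(1)[OF A, of undefined] by (cases "mat_inverse A") auto
  then show "mat_inv A \<in> carrier_mat r r" "A * mat_inv A = 1\<^sub>m r" "mat_inv A * A = 1\<^sub>m r"
    using mat_inverse(2)[OF A B] by (simp_all add: mat_inv_def)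
qed

lemma left_inverse_unique:
  fixes A :: "'a :: comm_ring_1 mat"
  assumes "A \<in> carrier_mat r r" "B \<in> carrier_mat r r" "B' \<in> carrier_mat r r"
    and "B * A = 1\<^sub>m r" "A * B' = 1\<^sub>m r"
  shows "B = B'"
  using assoc_mult_mat[of B r r A r B' r] assms by simp

text \<open>A right inverse suffices: \<open>det A * det B = 1\<close> already makes
  \<open>A\<close> invertible, and its left inverse must then agree with \<open>B\<close>.\<close>

lemma mat_inv_eqI:
  assumes A: "A \<in> carrier_mat r r" and B: "B \<in> carrier_mat r r" and AB: "A * B = 1\<^sub>m r"
  shows "mat_inv A = B"
proof -
  have "det A * det B = 1"
    using det_mult[OF A B] AB by simp
  then have "det A \<noteq> 0" by auto
  from mat_inv_inverse[OF A this] show ?thesis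
    using left_inverse_unique[OF A _ B _ AB] by simp
qed

text \<open>The form of \<open>U * A * mat_adjoint U\<close> at \<open>v\<close> is the form of
  \<open>A\<close> at \<open>w = mat_adjoint U *\<^sub>v v\<close>, and \<open>w\<close> is nonzero
  because \<open>mat_adjoint U\<close> is invertible too.\<close>

lemma pos_def_congruence:
  assumes A: "A \<in> carrier_mat r r" "pos_def_mat A"
    and U: "U \<in> carrier_mat r r" "det U \<noteq> 0"
  shows "pos_def_mat (U * A * mat_adjoint U)"
proof (rule pos_def_matI[where r = r])
  have car: "mat_adjoint U \<in> carrier_mat r r" "U * A \<in> carrier_mat r r"
    using A U by auto
  then show UA: "U * A * mat_adjoint U \<in> carrier_mat r r" by auto
  show "mat_adjoint (U * A * mat_adjoint U) = U * A * mat_adjoint U"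
    using A U car
    by (simp add: mat_adjoint_mult[of _ r r _ r] pos_def_matD(1) assoc_mult_mat[of _ r r _ r _ r])
  fix v :: "complex vec" assume v: "v \<in> carrier_vec r" "v \<noteq> 0\<^sub>v r"
  define w where "w = mat_adjoint U *\<^sub>v v"
  have w: "w \<in> carrier_vec r" using car v by (auto simp: w_def)
  have "det (mat_adjoint U) \<noteq> 0" using U by (simp add: det_mat_adjoint)
  then have "w \<noteq> 0\<^sub>v r"
    using det_0_iff_vec_prod_zero[OF car(1)] v by (auto simp: w_def)
  then have "0 < (A *\<^sub>v w) \<bullet>c w" using A w by (simp add: pos_def_matD(2))
  also have "\<dots> = (U *\<^sub>v (A *\<^sub>v w)) \<bullet>c v"
    using cscalar_prod_adjoint[OF U(1) _ v(1), of "A *\<^sub>v w"] A w by (simp add: w_def)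
  also have "U *\<^sub>v (A *\<^sub>v w) = (U * A * mat_adjoint U) *\<^sub>v v"
    using assoc_mult_mat_vec[OF U(1) A(1) w] assoc_mult_mat_vec[OF car(2,1) v(1)]
    by (simp add: w_def)
  finally show "0 < (U * A * mat_adjoint U *\<^sub>v v) \<bullet>c v" .
qed

section \<open>Cholesky factorization\<close>

lemma pos_def_diag_pos:
  assumes A: "A \<in> carrier_mat r r" "pos_def_mat A" and i: "i < r"
  shows "0 < A $$ (i, i)"
proof -
  have "unit_vec r i \<noteq> (0\<^sub>v r :: complex vec)"
    using i by (metis index_unit_vec(1) index_zero_vec(1) zero_neq_one)
  then have "0 < (A *\<^sub>v unit_vec r i) \<bullet>c (unit_vec r i :: complex vec)"
    using A by (simp add: pos_def_matD(2))
  moreover have "conjugate (unit_vec r i) = (unit_vec r i :: complex vec)"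
    by (rule eq_vecI) (auto simp: unit_vec_def)
  ultimately show ?thesis using A i by simp
qed

text \<open>Induction on the size: splitting off the first row and column leaves the Schur
  complement of the corner entry, which is again positive definite. Its factor is bordered by a
  scaled first column of \<open>A\<close>.\<close>

lemma cholesky_decomposition:
  assumes "A \<in> carrier_mat r r" "pos_def_mat A"
  shows "\<exists>L \<in> carrier_mat r r. (\<forall>i j. i < j \<longrightarrow> j < r \<longrightarrow> L $$ (i, j) = 0) \<and>
           (\<forall>i < r. 0 < L $$ (i, i)) \<and> L * mat_adjoint L = A"
  using assms
proof (induction r arbitrary: A)
  case 0
  then have "1\<^sub>m 0 * mat_adjoint (1\<^sub>m 0) = A" by (intro eq_matI) auto
  then show ?case by (intro bexI[of _ "1\<^sub>m 0"]) auto
next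
  case (Suc r)
  note A = Suc.prems(1)
  have herm: "cnj (A $$ (i, j)) = A $$ (j, i)" if "i < Suc r" "j < Suc r" for i j
    using arg_cong[OF pos_def_matD(1)[OF Suc.prems(2,1)], of "\<lambda>B. B $$ (j, i)"] that A by simp
  have a: "0 < A $$ (0, 0)" using pos_def_diag_pos[OF Suc.prems] by simp
  define a where "a = Re (A $$ (0, 0))"
  have Aa: "A $$ (0, 0) = of_real a" and apos: "a > 0"
    using a by (auto simp: a_def less_complex_def complex_eq_iff)
  \<comment> \<open>the Schur complement of the corner entry\<close>
  define S where "S = mat r r (\<lambda>(i, j). A $$ (Suc i, Suc j) - A $$ (Suc i, 0) * A $$ (0, Suc j) / a)"
  have S: "S \<in> carrier_mat r r" by (simp add: S_def)
  have "pos_def_mat S"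
  proof (rule pos_def_matI[OF S])
    show "mat_adjoint S = S"
      by (rule eq_matI) (auto simp: S_def herm mult.commute)
    fix w :: "complex vec" assume w: "w \<in> carrier_vec r" "w \<noteq> 0\<^sub>v r"
    \<comment> \<open>chosen so that the first entry of \<open>A *\<^sub>v v\<close> vanishes\<close>
    define t where "t = - (\<Sum>j<r. A $$ (0, Suc j) * w $ j) / a"
    define v where "v = vCons t w"
    have v: "v \<in> carrier_vec (Suc r)" using w by (simp add: v_def)
    obtain i where "i < r" "w $ i \<noteq> 0" using w by (metis carrier_vecD eq_vecI index_zero_vec)
    then have "v \<noteq> 0\<^sub>v (Suc r)"
      by (metis Suc_less_eq index_zero_vec(1) v_def vec_index_vCons_Suc)
    then have "0 < (A *\<^sub>v v) \<bullet>c v" using pos_def_matD(2)[OF Suc.prems(2,1) v] by simp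
    \<comment> \<open>With the first entry equal to 0, the form of \<open>A\<close> at
      \<open>v\<close> collapses to the form of \<open>S\<close> at \<open>w\<close>, whatever
      \<open>t\<close> is.\<close>
    also have "A *\<^sub>v v = vCons 0 (S *\<^sub>v w)"
    proof (rule eq_vecI)
      fix i assume "i < dim_vec (vCons 0 (S *\<^sub>v w))"
      then have i: "i < Suc r" by (simp add: S_def)
      \<comment> \<open>The sum has to be split at its first index, so the rules that would peel off
        the last summand are disabled.\<close>
      have "(A *\<^sub>v v) $ i = A $$ (i, 0) * t + (\<Sum>j<r. A $$ (i, Suc j) * w $ j)"
        using A i w v
        by (simp add: v_def scalar_prod_def sum.lessThan_Suc_shift atLeast0LessThan
            del: sum.op_ivl_Suc sum.lessThan_Suc)
      also have "\<dots> = vCons 0 (S *\<^sub>v w) $ i"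
      proof (cases i)
        case 0
        then show ?thesis using apos by (simp add: t_def Aa)
      next
        case (Suc k)
        then show ?thesis using i w
          by (simp add: t_def S_def scalar_prod_def atLeast0LessThan sum_subtractf algebra_simps
              sum_distrib_left sum_divide_distrib)
      qed
      finally show "(A *\<^sub>v v) $ i = vCons 0 (S *\<^sub>v w) $ i" .
    qed (use A in \<open>simp add: S_def\<close>)
    also have "vCons 0 (S *\<^sub>v w) \<bullet>c v = (S *\<^sub>v w) \<bullet>c w"
      using w by (simp add: v_def scalar_prod_def sum.lessThan_Suc_shift atLeast0LessThan
            del: sum.op_ivl_Suc sum.lessThan_Suc)
    finally show "0 < (S *\<^sub>v w) \<bullet>c w" .
  qed
  from Suc.IH[OF S this] obtain L where L: "L \<in> carrier_mat r r"
    and low: "\<And>i j. i < j \<Longrightarrow> j < r \<Longrightarrow> L $$ (i, j) = 0"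
    and diag: "\<And>i. i < r \<Longrightarrow> 0 < L $$ (i, i)" and LL: "L * mat_adjoint L = S"
    by blast
  have LLij: "(\<Sum>k<r. L $$ (i, k) * cnj (L $$ (j, k))) = S $$ (i, j)" if "i < r" "j < r" for i j
    using arg_cong[OF LL, of "\<lambda>B. B $$ (i, j)"] that L by (simp add: scalar_prod_def atLeast0LessThan)
  have sq: "complex_of_real (sqrt a) * of_real (sqrt a) = of_real a"
    using apos by (simp flip: of_real_mult)
  \<comment> \<open>In block form: first column \<open>A $$ (i, 0) / sqrt a\<close> (for
    \<open>i = 0\<close> this is \<open>sqrt a\<close>), zeros in the rest of the first row, and
    \<open>L\<close> in the lower right corner.\<close>
  define M where "M = mat (Suc r) (Suc r) (\<lambda>(i, j). case i of
      0 \<Rightarrow> if j = 0 then of_real (sqrt a) else 0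
    | Suc i' \<Rightarrow> (case j of 0 \<Rightarrow> A $$ (i, 0) / of_real (sqrt a) | Suc j' \<Rightarrow> L $$ (i', j')))"
  have "M * mat_adjoint M = A"
  proof (rule eq_matI)
    fix i j assume "i < dim_row A" "j < dim_col A"
    then have ij: "i < Suc r" "j < Suc r" using A by auto
    have *: "(M * mat_adjoint M) $$ (i, j) =
        M $$ (i, 0) * cnj (M $$ (j, 0)) + (\<Sum>k<r. M $$ (i, Suc k) * cnj (M $$ (j, Suc k)))"
      using ij by (simp add: M_def scalar_prod_def sum.lessThan_Suc_shift atLeast0LessThan
            del: sum.op_ivl_Suc sum.lessThan_Suc)
    show "(M * mat_adjoint M) $$ (i, j) = A $$ (i, j)"
    proof (cases i; cases j)
      \<comment> \<open>The product of the two first-column entries restores exactly the rank-one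
        term that was subtracted in \<open>S\<close>.\<close>
      fix i' j' assume [simp]: "i = Suc i'" "j = Suc j'"
      show ?thesis
        unfolding * using ij LLij[of i' j'] sq apos herm
        by (simp add: M_def S_def)
    next
      fix i' assume "i = Suc i'" "j = 0"
      then show ?thesis unfolding * using ij sq apos by (simp add: M_def)
    next
      fix j' assume "i = 0" "j = Suc j'"
      then show ?thesis unfolding * using ij sq apos herm by (simp add: M_def)
    next
      assume "i = 0" "j = 0"
      then show ?thesis unfolding * using sq Aa by (simp add: M_def)
    qed
  qed (use A in \<open>auto simp: M_def\<close>)
  moreover have "M \<in> carrier_mat (Suc r) (Suc r)" by (simp add: M_def)
  moreover have "M $$ (i, j) = 0" if "i < j" "j < Suc r" for i j
    using that low by (auto simp: M_def split: nat.split)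
  moreover have "0 < M $$ (i, i)" if "i < Suc r" for i
    using that diag apos by (auto simp: M_def less_complex_def split: nat.split)
  ultimately show ?case by blast
qed

section \<open>Sums, Gram matrices, determinants and inverses\<close>

lemma pos_def_add_pos_semidef:
  assumes A: "A \<in> carrier_mat r r" "pos_semidef_mat A"
    and B: "B \<in> carrier_mat r r" "pos_def_mat B"
  shows "pos_def_mat (A + B)"
proof (rule pos_def_matI[where r = r])
  show "mat_adjoint (A + B) = A + B"
    using A B by (simp add: mat_adjoint_add pos_def_matD(1) pos_semidef_mat_def hermitian_mat_def)
  fix v :: "complex vec" assume v: "v \<in> carrier_vec r" "v \<noteq> 0\<^sub>v r"
  have "((A + B) *\<^sub>v v) \<bullet>c v = (A *\<^sub>v v) \<bullet>c v + (B *\<^sub>v v) \<bullet>c v"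
    using A B v by (simp add: add_mult_distrib_mat_vec add_scalar_prod_distrib[of _ r])
  moreover have "0 \<le> (A *\<^sub>v v) \<bullet>c v" using A v by (simp add: pos_semidef_mat_def)
  moreover have "0 < (B *\<^sub>v v) \<bullet>c v" using B v by (simp add: pos_def_matD(2))
  ultimately show "0 < ((A + B) *\<^sub>v v) \<bullet>c v" by (simp add: add_nonneg_pos)
qed (use A B in auto)

text \<open>The quadratic form at \<open>v\<close> is the squared norm of
  \<open>B *\<^sub>v v\<close>.\<close>

lemma pos_semidef_gram:
  fixes B :: "complex mat"
  assumes B: "B \<in> carrier_mat n r"
  shows "pos_semidef_mat (mat_adjoint B * B)"
proof -
  have B': "mat_adjoint B \<in> carrier_mat r n" using B by simp
  have "0 \<le> (mat_adjoint B * B *\<^sub>v v) \<bullet>c v" if v: "v \<in> carrier_vec r" for v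
  proof -
    have Bv: "B *\<^sub>v v \<in> carrier_vec n" using B v by simp
    have "(mat_adjoint B * B *\<^sub>v v) \<bullet>c v = (B *\<^sub>v v) \<bullet>c (B *\<^sub>v v)"
      using cscalar_prod_adjoint[OF B' Bv v] assoc_mult_mat_vec[OF B' B v] by simp
    then show ?thesis using conjugate_square_ge_0_vec by simp
  qed
  then show ?thesis
    using B by (simp add: pos_semidef_mat_def hermitian_mat_def mat_adjoint_mult[OF B' B])
qed

lemma pos_def_one: "pos_def_mat (1\<^sub>m r)"
  by (rule pos_def_matI[of _ r]) (auto simp: conjugate_square_greater_0_vec)

text \<open>With a Cholesky factor \<open>L\<close>, the determinant is \<open>|det L|^2\<close>,
  and \<open>det L\<close> is a product of positive diagonal entries. In the order on complex
  numbers this also says that \<open>det A\<close> is real.\<close>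

lemma det_pos_def:
  assumes A: "A \<in> carrier_mat r r" "pos_def_mat A"
  shows "0 < det A"
proof -
  obtain L where L: "L \<in> carrier_mat r r" "\<And>i j. i < j \<Longrightarrow> j < r \<Longrightarrow> L $$ (i, j) = 0"
    "\<And>i. i < r \<Longrightarrow> 0 < L $$ (i, i)" and LL: "L * mat_adjoint L = A"
    using cholesky_decomposition[OF A] by blast
  have "det L = (\<Prod>i = 0..<r. L $$ (i, i))"
    using det_lower_triangular[OF L(2,1)] L(1) by (simp add: prod_list_diag_prod)
  moreover have "(\<Prod>i = 0..<r. L $$ (i, i)) \<noteq> 0" using L(3) by fastforce
  moreover have "det A = det L * conjugate (det L)"
    using det_mult[OF L(1) mat_adjoint_carrier[OF L(1)]] LL L(1) by (simp add: det_mat_adjoint)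
  ultimately show ?thesis by (simp only: conjugate_square_greater_0 not_False_eq_True)
qed

text \<open>Only the factorization is kept here, not the triangular shape: \<open>U\<close> is the
  inverse of \<open>T\<close>, so that congruence by \<open>U\<close> takes \<open>Z\<close> to the
  identity and congruence by \<open>T\<close> undoes it.\<close>

lemma pos_def_inverse_factor:
  assumes Z: "Z \<in> carrier_mat r r" "pos_def_mat Z"
  obtains T U where "T \<in> carrier_mat r r" "U \<in> carrier_mat r r"
    "T * mat_adjoint T = Z" "U * T = 1\<^sub>m r" "T * U = 1\<^sub>m r" "mat_inv Z = mat_adjoint U * U"
proof -
  obtain T where T: "T \<in> carrier_mat r r" and TT: "T * mat_adjoint T = Z"
    using cholesky_decomposition[OF Z] by blast
  note T' = mat_adjoint_carrier[OF T]
  have "det T \<noteq> 0"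
    using det_pos_def[OF Z] det_mult[OF T T'] TT by auto
  note U = mat_inv_inverse[OF T this]
  note U' = mat_adjoint_carrier[OF U(1)]
  have "mat_adjoint T * mat_adjoint (mat_inv T) = 1\<^sub>m r"
    using mat_adjoint_mult[OF U(1) T] U(3) by simp
  then have "mat_adjoint T * (mat_adjoint (mat_inv T) * mat_inv T) = mat_inv T"
    using assoc_mult_mat[OF T' U' U(1)] U(1) by simp
  then have "Z * (mat_adjoint (mat_inv T) * mat_inv T) = 1\<^sub>m r"
    using assoc_mult_mat[OF T T' mult_carrier_mat[OF U' U(1)]] U(2) TT by simp
  then have "mat_inv Z = mat_adjoint (mat_inv T) * mat_inv T"
    using mat_inv_eqI[OF Z(1) mult_carrier_mat[OF U' U(1)]] by simp
  then show thesis using that[OF T U(1) TT U(3,2)] by simp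
qed

section \<open>The trace\<close>

lemma mat_trace_add:
  "A \<in> carrier_mat r r \<Longrightarrow> B \<in> carrier_mat r r \<Longrightarrow> mat_trace (A + B) = mat_trace A + mat_trace B"
  by (simp add: mat_trace_def sum.distrib)

lemma mat_trace_minus:
  "A \<in> carrier_mat r r \<Longrightarrow> B \<in> carrier_mat r r \<Longrightarrow> mat_trace (A - B) = mat_trace A - mat_trace B"
  by (simp add: mat_trace_def sum_subtractf)

lemma mat_trace_one [simp]: "mat_trace (1\<^sub>m r) = of_nat r"
  by (simp add: mat_trace_def)

lemma mat_trace_comm:
  assumes "A \<in> carrier_mat r s" "B \<in> carrier_mat s r"
  shows "mat_trace (A * B) = mat_trace (B * A)"
proof -
  have "mat_trace (A * B) = (\<Sum>i<r. \<Sum>k<s. A $$ (i, k) * B $$ (k, i))"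
    using assms by (simp add: mat_trace_def scalar_prod_def atLeast0LessThan)
  also have "\<dots> = (\<Sum>k<s. \<Sum>i<r. A $$ (i, k) * B $$ (k, i))" by (rule sum.swap)
  also have "\<dots> = mat_trace (B * A)"
    using assms by (simp add: mat_trace_def scalar_prod_def atLeast0LessThan mult.commute)
  finally show ?thesis .
qed

section \<open>The log-det bound\<close>

text \<open>The eigenvalue inequality \<open>ln x \<le> x - 1\<close> without eigenvalues: squared
  diagonal entries of a Cholesky factor take their place, and off-diagonal entries can only increase
  the trace.\<close>

lemma log_det_le_trace:
  assumes M: "M \<in> carrier_mat r r" "pos_def_mat M"
  shows "log_det M \<le> Re (mat_trace M) - real r"
    and "log_det M = Re (mat_trace M) - real r \<Longrightarrow> M = 1\<^sub>m r"
proof -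
  obtain L where L: "L \<in> carrier_mat r r" and low: "\<And>i j. i < j \<Longrightarrow> j < r \<Longrightarrow> L $$ (i, j) = 0"
    and diag: "\<And>i. i < r \<Longrightarrow> 0 < L $$ (i, i)" and LL: "L * mat_adjoint L = M"
    using cholesky_decomposition[OF M] by blast
  define l where "l i = Re (L $$ (i, i))" for i
  have l: "L $$ (i, i) = of_real (l i)" "l i > 0" if "i < r" for i
    using diag[OF that] by (auto simp: l_def less_complex_def complex_eq_iff)
  have "det L = (\<Prod>i<r. L $$ (i, i))"
    using det_lower_triangular[OF low L] L by (simp add: prod_list_diag_prod atLeast0LessThan)
  also have "\<dots> = of_real (\<Prod>i<r. l i)" by (simp add: l)
  finally have "det M = of_real ((\<Prod>i<r. l i) * (\<Prod>i<r. l i))"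
    using det_mult[OF L mat_adjoint_carrier[OF L]] LL by (simp add: det_mat_adjoint[OF L])
  then have "log_det M = ln (\<Prod>i<r. l i ^ 2)"
    by (simp add: log_det_def power2_eq_square prod.distrib del: of_real_prod of_real_mult)
  also have "\<dots> = (\<Sum>i<r. ln (l i ^ 2))" by (rule ln_prod) (use l(2) in fastforce)+
  finally have ld: "log_det M = (\<Sum>i<r. ln (l i ^ 2))" .
  \<comment> \<open>The off-diagonal part of row \<open>i\<close> in the squared Frobenius norm of
    \<open>L\<close>, which equals the trace of \<open>M\<close>.\<close>
  define q where "q i = (\<Sum>k\<in>{..<r} - {i}. (cmod (L $$ (i, k)))\<^sup>2)" for i
  have "Re (M $$ (i, i)) = l i ^ 2 + q i" if i: "i < r" for i
  proof -
    have "M $$ (i, i) = (\<Sum>k<r. L $$ (i, k) * cnj (L $$ (i, k)))"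
      using i L by (simp flip: LL add: scalar_prod_def atLeast0LessThan)
    also have "\<dots> = of_real (\<Sum>k<r. (cmod (L $$ (i, k)))\<^sup>2)"
      by (simp only: complex_norm_square of_real_sum)
    also have "(\<Sum>k<r. (cmod (L $$ (i, k)))\<^sup>2) = l i ^ 2 + q i"
      using i l by (simp add: q_def sum.remove[of "{..<r}" i])
    finally show ?thesis by simp
  qed
  then have tr: "Re (mat_trace M) - real r = (\<Sum>i<r. l i ^ 2 + q i - 1)"
    using M by (simp add: mat_trace_def sum_subtractf)
  have q: "q i \<ge> 0" for i by (simp add: q_def sum_nonneg)
  have ln_le: "ln (l i ^ 2) \<le> l i ^ 2 - 1" if "i < r" for i
    using l(2)[OF that] by (intro ln_le_minus_one) simp
  have le: "ln (l i ^ 2) \<le> l i ^ 2 + q i - 1" if "i < r" for i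
    using ln_le[OF that] q[of i] by linarith
  show "log_det M \<le> Re (mat_trace M) - real r"
    unfolding ld tr by (rule sum_mono) (use le in simp)
  assume "log_det M = Re (mat_trace M) - real r"
  then have "(\<Sum>i<r. (l i ^ 2 + q i - 1) - ln (l i ^ 2)) = 0"
    by (simp add: ld tr sum_subtractf)
  \<comment> \<open>All gaps between the two sides are nonnegative and add up to 0, so each of them
    vanishes.\<close>
  then have eq: "ln (l i ^ 2) = l i ^ 2 + q i - 1" if "i < r" for i
    using sum_nonneg_eq_0_iff[of "{..<r}" "\<lambda>i. (l i ^ 2 + q i - 1) - ln (l i ^ 2)"] le that by auto
  have "L = 1\<^sub>m r"
  proof (rule eq_matI)
    fix i j assume "i < dim_row (1\<^sub>m r :: complex mat)" "j < dim_col (1\<^sub>m r :: complex mat)"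
    then have i: "i < r" and j: "j < r" by auto
    \<comment> \<open>For \<open>x = l i ^ 2\<close>, the chain
      \<open>ln x \<le> x - 1 \<le> x + q i - 1 = ln x\<close> is tight, which forces
      \<open>x = 1\<close> and \<open>q i = 0\<close>.\<close>
    have "l i ^ 2 = 1"
      using ln_eq_minus_one[of "l i ^ 2"] eq[OF i] ln_le[OF i] q[of i] l(2)[OF i] by simp
    moreover from this have "q i = 0" using eq[OF i] by simp
    moreover have "l i = 1" using \<open>l i ^ 2 = 1\<close> l(2)[OF i] by (simp add: power2_eq_1_iff)
    ultimately show "L $$ (i, j) = 1\<^sub>m r $$ (i, j)"
      using i j l by (cases "i = j") (auto simp: q_def sum_nonneg_eq_0_iff)
  qed (use L in auto)
  then show "M = 1\<^sub>m r" using LL by simp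
qed

text \<open>Congruence by \<open>U\<close> turns \<open>Z\<close> into the identity and
  \<open>S\<close> into \<open>M\<close>; the gap between the bound and \<open>log_det Z\<close>
  becomes the gap in \<open>log_det_le_trace\<close> for \<open>M\<close>.\<close>

lemma log_det_bound_le:
  assumes S: "S \<in> carrier_mat r r" "pos_def_mat S" and Z: "Z \<in> carrier_mat r r" "pos_def_mat Z"
  shows "log_det_bound S Z \<le> log_det Z"
    and "log_det_bound S Z = log_det Z \<Longrightarrow> S = Z"
proof -
  obtain T U where T: "T \<in> carrier_mat r r" and U: "U \<in> carrier_mat r r"
    and TT: "T * mat_adjoint T = Z" and UT: "U * T = 1\<^sub>m r" and TU: "T * U = 1\<^sub>m r"
    and invZ: "mat_inv Z = mat_adjoint U * U"
    using pos_def_inverse_factor[OF Z] by blast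
  note T' = mat_adjoint_carrier[OF T] and U' = mat_adjoint_carrier[OF U]
  define M where "M = U * S * mat_adjoint U"
  have M: "M \<in> carrier_mat r r"
    using mult_carrier_mat[OF mult_carrier_mat[OF U S(1)] U'] by (simp add: M_def)
  have detUT: "det U * det T = 1" using det_mult[OF U T] UT by simp
  then have pd: "pos_def_mat M"
    unfolding M_def by (intro pos_def_congruence[OF S U]) auto
  have cnjUT: "cnj (det U) * cnj (det T) = 1"
    using arg_cong[OF detUT, of cnj] by simp
  have "det M * det Z = (det U * det T) * (cnj (det U) * cnj (det T)) * det S"
    using det_mult[OF mult_carrier_mat[OF U S(1)] U'] det_mult[OF U S(1)] det_mult[OF T T']
      det_mat_adjoint[OF U] det_mat_adjoint[OF T]
    by (simp add: M_def flip: TT)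
  then have "det M * det Z = det S" by (simp add: detUT cnjUT)
  \<comment> \<open>Both determinants on the left of \<open>det M * det Z = det S\<close> are real
    and positive, so real part and logarithm both split over the product.\<close>
  then have "log_det S = log_det M + log_det Z"
    using det_pos_def[OF M pd] det_pos_def[OF Z]
    by (auto simp: log_det_def less_complex_def ln_mult simp flip: \<open>det M * det Z = det S\<close>)
  moreover have "mat_trace (S * mat_inv Z) = mat_trace M"
    using mat_trace_comm[OF U mult_carrier_mat[OF S(1) U']] assoc_mult_mat[OF U S(1) U']
      assoc_mult_mat[OF S(1) U' U]
    by (simp add: invZ M_def)
  moreover have "S * mat_inv Z \<in> carrier_mat r r"
    using mult_carrier_mat[OF S(1) mult_carrier_mat[OF U' U]] by (simp add: invZ)
  ultimately have bound:
    "log_det_bound S Z = log_det Z + (log_det M - (Re (mat_trace M) - real r))"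
    using Z by (simp add: log_det_bound_def mat_trace_minus[of _ r])
  show "log_det_bound S Z \<le> log_det Z"
    using log_det_le_trace(1)[OF M pd] bound by simp
  assume "log_det_bound S Z = log_det Z"
  then have "M = 1\<^sub>m r" using log_det_le_trace(2)[OF M pd] bound by simp
  \<comment> \<open>Congruence by \<open>T\<close> undoes the one by \<open>U\<close>; for
    \<open>M = 1\<^sub>m r\<close> the left side is \<open>Z\<close>.\<close>
  moreover have "T * M * mat_adjoint T = S"
  proof -
    have UT': "mat_adjoint U * mat_adjoint T = 1\<^sub>m r"
      using mat_adjoint_mult[OF T U] TU by simp
    have "T * M = S * mat_adjoint U"
      using assoc_mult_mat[OF T U mult_carrier_mat[OF S(1) U']] assoc_mult_mat[OF U S(1) U']
        TU S(1) U' by (simp add: M_def)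
    then show ?thesis
      using assoc_mult_mat[OF S(1) U' T'] UT' S(1) by simp
  qed
  ultimately show "S = Z" using TT T by simp
qed

lemma log_det_bound_self:
  assumes Z: "Z \<in> carrier_mat r r" "pos_def_mat Z"
  shows "log_det_bound Z Z = log_det Z"
proof -
  have "det Z \<noteq> 0" using det_pos_def[OF Z] by auto
  then show ?thesis
    using mat_inv_inverse[OF Z(1)] Z(1) by (simp add: log_det_bound_def mat_trace_minus[of _ r])
qed

section \<open>The transformed objective\<close>

text \<open>Factoring the inverse of \<open>D\<close> as \<open>mat_adjoint U * U\<close> exhibits
  the second summand as the Gram matrix of \<open>U * R\<close>.\<close>

lemma pos_def_one_plus_gram:
  assumes D: "D \<in> carrier_mat n n" "pos_def_mat D" and R: "R \<in> carrier_mat n r"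
  shows "pos_def_mat (1\<^sub>m r + mat_adjoint R * mat_inv D * R)"
proof -
  obtain U where U: "U \<in> carrier_mat n n" and invD: "mat_inv D = mat_adjoint U * U"
    using pos_def_inverse_factor[OF D] by blast
  note R' = mat_adjoint_carrier[OF R] and U' = mat_adjoint_carrier[OF U]
  have UR: "U * R \<in> carrier_mat n r" using U R by simp
  have "mat_adjoint R * mat_inv D * R = mat_adjoint (U * R) * (U * R)"
    using assoc_mult_mat[OF R' U' U] mat_adjoint_mult[OF U R]
      assoc_mult_mat[OF mult_carrier_mat[OF R' U'] U R] by (simp add: invD)
  moreover have "pos_def_mat (mat_adjoint (U * R) * (U * R) + 1\<^sub>m r)"
    using mult_carrier_mat[OF mat_adjoint_carrier[OF UR] UR]
    by (intro pos_def_add_pos_semidef[of _ r] pos_semidef_gram[OF UR] pos_def_one) auto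
  moreover have "mat_adjoint (U * R) * (U * R) + 1\<^sub>m r = 1\<^sub>m r + mat_adjoint (U * R) * (U * R)"
    using R by (intro comm_add_mat[of _ r r]) (auto intro!: carrier_matI)
  ultimately show ?thesis by simp
qed

text \<open>For \<open>G = P * Q * R\<close> and \<open>H = P * V * R\<close>, the claim is
  \<open>(1 + G) * (1 - H) = 1\<close>, that is, \<open>G * H + H = G\<close>. This is the resolvent
  identity for \<open>Q\<close> and \<open>V\<close> multiplied by \<open>P\<close> and
  \<open>R\<close>.\<close>

lemma woodbury:
  assumes D: "D \<in> carrier_mat n n" "det D \<noteq> 0"
    and R: "R \<in> carrier_mat n r" and P: "P \<in> carrier_mat r n" and W: "det (R * P + D) \<noteq> 0"
  shows "mat_inv (1\<^sub>m r + P * mat_inv D * R) = 1\<^sub>m r - P * mat_inv (R * P + D) * R"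
proof -
  define Q where "Q = mat_inv D"
  define V where "V = mat_inv (R * P + D)"
  have RP: "R * P \<in> carrier_mat n n" using R P by simp
  have Q: "Q \<in> carrier_mat n n" "Q * D = 1\<^sub>m n"
    using mat_inv_inverse[OF D] by (simp_all add: Q_def)
  have V: "V \<in> carrier_mat n n" "(R * P + D) * V = 1\<^sub>m n"
    using mat_inv_inverse[OF _ W] RP D by (simp_all add: V_def)
  have QRP: "Q * (R * P) \<in> carrier_mat n n" using Q RP by simp
  define G where "G = P * Q * R"
  define H where "H = P * V * R"
  have G: "G \<in> carrier_mat r r" and H: "H \<in> carrier_mat r r"
    using P Q V R by (simp_all add: G_def H_def)
  \<comment> \<open>Inserting \<open>(R * P + D) * V = 1\<close> and expanding with
    \<open>Q * D = 1\<close> yields the resolvent identity.\<close>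
  have "Q = Q * ((R * P + D) * V)" using V Q by simp
  also have "\<dots> = (Q * (R * P + D)) * V"
    using Q V RP D by (intro assoc_mult_mat[symmetric]) auto
  also have "Q * (R * P + D) = Q * (R * P) + 1\<^sub>m n"
    using mult_add_distrib_mat[OF Q(1) RP D(1)] Q(2) by simp
  also have "\<dots> * V = Q * (R * P) * V + V"
    using add_mult_distrib_mat[OF QRP _ V(1), of "1\<^sub>m n"] V(1) by simp
  finally have Qeq: "Q = Q * (R * P) * V + V" .
  have "G * H = P * (Q * (R * P) * V) * R"
    using P Q(1) V(1) R RP QRP
    by (simp add: G_def H_def assoc_mult_mat[of _ r n _ n _ r] assoc_mult_mat[of _ n n _ n _ r]
        assoc_mult_mat[of _ n r _ n _ r] assoc_mult_mat[of _ r n _ r _ r]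
        assoc_mult_mat[of _ n n _ r _ r] assoc_mult_mat[of _ n n _ r _ n]
        assoc_mult_mat[of _ n n _ n _ n] assoc_mult_mat[of _ n r _ n _ n])
  then have "G * H + H = (P * (Q * (R * P) * V) + P * V) * R"
    using add_mult_distrib_mat[of "P * (Q * (R * P) * V)" r n "P * V" R r] P QRP V(1) R
    by (simp add: H_def)
  also have "P * (Q * (R * P) * V) + P * V = P * Q"
    using mult_add_distrib_mat[OF P mult_carrier_mat[OF QRP V(1)] V(1)] Qeq by simp
  finally have GH: "G * H + H = G" by (simp add: G_def)
  have "(1\<^sub>m r + G) * (1\<^sub>m r - H) = (1\<^sub>m r - H) + (G - G * H)"
    using G H add_mult_distrib_mat[OF one_carrier_mat G minus_carrier_mat[OF H], of "1\<^sub>m r"]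
      left_mult_one_mat[OF minus_carrier_mat[OF H]] mult_minus_distrib_mat[OF G one_carrier_mat H] by simp
  also have "\<dots> = 1\<^sub>m r"
  \<comment> \<open>The cancellation is carried out entrywise; entries of \<open>G * H\<close> must
    stay folded to match those in \<open>GH\<close>.\<close>
  proof (rule eq_matI)
    fix i j assume "i < dim_row (1\<^sub>m r :: complex mat)" "j < dim_col (1\<^sub>m r :: complex mat)"
    then have "(G * H) $$ (i, j) + H $$ (i, j) = G $$ (i, j)" "i < r" "j < r"
      using arg_cong[OF GH, of "\<lambda>A. A $$ (i, j)"] H by auto
    then show "((1\<^sub>m r - H) + (G - G * H)) $$ (i, j) = 1\<^sub>m r $$ (i, j)"
      using G H by (simp add: algebra_simps del: index_mult_mat(1))
  qed (use G H in auto)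
  finally show ?thesis
    using mat_inv_eqI[of "1\<^sub>m r + G" r "1\<^sub>m r - H"] G minus_carrier_mat[OF H] by (simp add: G_def H_def Q_def V_def)
qed

text \<open>By \<open>woodbury\<close> the inverse of the second argument is \<open>1 - H\<close>,
  so for \<open>S = 1 + \<Gamma>\<close> the trace in the bound is
  \<open>tr (1 - S + S * H) = tr (S * H) - tr \<Gamma>\<close>.\<close>

lemma dual_term_eq:
  assumes D: "D \<in> carrier_mat n n" "pos_def_mat D" and R: "R \<in> carrier_mat n r"
    and C: "C \<in> carrier_mat n n" "pos_semidef_mat C" "R * mat_adjoint R = C"
    and \<Gamma>: "\<Gamma> \<in> carrier_mat r r"
  shows "log_det (1\<^sub>m r + \<Gamma>) - Re (mat_trace \<Gamma>) +
           Re (mat_trace ((1\<^sub>m r + \<Gamma>) * mat_adjoint R * mat_inv (C + D) * R)) =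
         log_det_bound (1\<^sub>m r + \<Gamma>) (1\<^sub>m r + mat_adjoint R * mat_inv D * R)"
proof -
  note R' = mat_adjoint_carrier[OF R]
  have CD: "C + D \<in> carrier_mat n n" using C D by simp
  have "det D \<noteq> 0" "det (C + D) \<noteq> 0"
    using det_pos_def[OF D] det_pos_def[OF CD pos_def_add_pos_semidef[OF C(1,2) D]] by auto
  then have inv: "mat_inv (1\<^sub>m r + mat_adjoint R * mat_inv D * R) =
      1\<^sub>m r - mat_adjoint R * mat_inv (C + D) * R"
    and V: "mat_inv (C + D) \<in> carrier_mat n n"
    using woodbury[OF D(1) _ R R'] C(3) mat_inv_inverse[OF CD] by simp_all
  define S where "S = 1\<^sub>m r + \<Gamma>"
  define H where "H = mat_adjoint R * mat_inv (C + D) * R"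
  have S: "S \<in> carrier_mat r r" and H: "H \<in> carrier_mat r r"
    using \<Gamma> R mult_carrier_mat[OF R' V] by (auto simp: S_def H_def)
  have SH: "S * mat_adjoint R * mat_inv (C + D) * R = S * H"
    using S R R' V assoc_mult_mat[OF S R' V] assoc_mult_mat[OF S mult_carrier_mat[OF R' V] R]
    by (simp add: H_def)
  have "S * (1\<^sub>m r - H) = S - S * H"
    using S mult_minus_distrib_mat[OF S one_carrier_mat H] by simp
  then have "mat_trace (1\<^sub>m r - S * (1\<^sub>m r - H)) = of_nat r - (mat_trace S - mat_trace (S * H))"
    using S mult_carrier_mat[OF S H] minus_carrier_mat[OF mult_carrier_mat[OF S H]]
    by (simp add: mat_trace_minus[of _ r])
  also have "\<dots> = mat_trace (S * H) - mat_trace \<Gamma>"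
    using \<Gamma> by (simp add: S_def mat_trace_add[of _ r])
  finally show ?thesis
    using R by (simp add: log_det_bound_def inv SH flip: S_def H_def)
qed

lemma one_add_diff_one:
  fixes A :: "'a :: comm_ring_1 mat"
  shows "A \<in> carrier_mat r r \<Longrightarrow> 1\<^sub>m r + (A - 1\<^sub>m r) = A"
    and "A \<in> carrier_mat r r \<Longrightarrow> (1\<^sub>m r + A) - 1\<^sub>m r = A"
  by (rule eq_matI; auto)+

text \<open>Equality of the sums forces equality in every summand, since the inequality holds
  termwise; positive weights then cancel.\<close>

lemma weighted_log_det_bound_le:
  fixes \<omega> :: "nat \<Rightarrow> real"
  assumes "\<And>k. k \<in> {1..K} \<Longrightarrow> \<omega> k > 0"
    and S: "\<And>k. k \<in> {1..K} \<Longrightarrow> S k \<in> carrier_mat (r k) (r k) \<and> pos_def_mat (S k)"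
    and Z: "\<And>k. k \<in> {1..K} \<Longrightarrow> Z k \<in> carrier_mat (r k) (r k) \<and> pos_def_mat (Z k)"
  shows "(\<Sum>k = 1..K. \<omega> k * log_det_bound (S k) (Z k)) \<le> (\<Sum>k = 1..K. \<omega> k * log_det (Z k))"
    and "(\<Sum>k = 1..K. \<omega> k * log_det_bound (S k) (Z k)) = (\<Sum>k = 1..K. \<omega> k * log_det (Z k)) \<Longrightarrow>
           k \<in> {1..K} \<Longrightarrow> S k = Z k"
proof -
  have le: "\<omega> k * log_det_bound (S k) (Z k) \<le> \<omega> k * log_det (Z k)" if "k \<in> {1..K}" for k
    using assms(1)[OF that] S[OF that] Z[OF that] log_det_bound_le(1)
    by (intro mult_left_mono) (auto intro: less_imp_le)
  then show "(\<Sum>k = 1..K. \<omega> k * log_det_bound (S k) (Z k)) \<le> (\<Sum>k = 1..K. \<omega> k * log_det (Z k))"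
    by (rule sum_mono)
  assume eq: "(\<Sum>k = 1..K. \<omega> k * log_det_bound (S k) (Z k)) = (\<Sum>k = 1..K. \<omega> k * log_det (Z k))"
    and k: "k \<in> {1..K}"
  have "\<omega> k * log_det_bound (S k) (Z k) = \<omega> k * log_det (Z k)"
    using sum_mono_inv[OF eq le k] by simp
  then show "S k = Z k"
    using assms(1)[OF k] S[OF k] Z[OF k] log_det_bound_le(2) by auto
qed


section \<open>The block update of the dual variables and the resulting surrogate\<close>

theorem proposition14:
  fixes \<X> :: "'x set" and X0 :: 'x
    and K :: nat and \<omega> :: "nat \<Rightarrow> real" and n m :: "nat \<Rightarrow> nat"
    and C D R :: "nat \<Rightarrow> 'x \<Rightarrow> complex mat"
  assumes weights: "\<And>k. k \<in> {1..K} \<Longrightarrow> \<omega> k > 0"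
    and C_dim: "\<And>k X. k \<in> {1..K} \<Longrightarrow> X \<in> \<X> \<Longrightarrow> C k X \<in> carrier_mat (n k) (n k)"
    and C_psd: "\<And>k X. k \<in> {1..K} \<Longrightarrow> X \<in> \<X> \<Longrightarrow> pos_semidef_mat (C k X)"
    and D_dim: "\<And>k X. k \<in> {1..K} \<Longrightarrow> X \<in> \<X> \<Longrightarrow> D k X \<in> carrier_mat (n k) (n k)"
    and D_pd: "\<And>k X. k \<in> {1..K} \<Longrightarrow> X \<in> \<X> \<Longrightarrow> pos_def_mat (D k X)"
    and R_dim: "\<And>k X. k \<in> {1..K} \<Longrightarrow> X \<in> \<X> \<Longrightarrow> R k X \<in> carrier_mat (n k) (m k)"
    and R_factor: "\<And>k X. k \<in> {1..K} \<Longrightarrow> X \<in> \<X> \<Longrightarrow> R k X * mat_adjoint (R k X) = C k X"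
    and X0: "X0 \<in> \<X>"
  shows
    "(\<exists>!\<Gamma>. is_arg_max (dual_objective K \<omega> m C R D X0) (\<lambda>\<Gamma>. \<Gamma> \<in> dual_feasible K m) \<Gamma>) \<and>
     (\<forall>\<Gamma>. is_arg_max (dual_objective K \<omega> m C R D X0) (\<lambda>\<Gamma>. \<Gamma> \<in> dual_feasible K m) \<Gamma> \<longrightarrow>
        (\<forall>X \<in> \<X>. dual_objective K \<omega> m C R D X \<Gamma> =
           (\<Sum>k = 1..K. \<omega> k * log_det_bound (Z_mat m R D k X0) (Z_mat m R D k X)))) \<and>
     surrogate_at \<X> (original_objective K \<omega> m R D) X0
       (\<lambda>X. \<Sum>k = 1..K. \<omega> k * log_det_bound (Z_mat m R D k X0) (Z_mat m R D k X)) \<and>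
     (\<forall>k \<in> {1..K}. \<forall>X \<in> \<X>.
        Z_mat m R D k X \<in> carrier_mat (m k) (m k) \<and> pos_def_mat (Z_mat m R D k X)) \<and>
     (\<forall>r. \<forall>Z \<in> carrier_mat r r. \<forall>Z' \<in> carrier_mat r r.
        pos_def_mat Z \<longrightarrow> pos_def_mat Z' \<longrightarrow>
          log_det Z \<ge> log_det_bound Z' Z \<and> log_det_bound Z Z = log_det Z)"
proof -
  let ?I = "{1..K}"
  let ?f = "dual_objective K \<omega> m C R D"
  let ?Z = "Z_mat m R D"
  have Z: "?Z k X \<in> carrier_mat (m k) (m k) \<and> pos_def_mat (?Z k X)" if "k \<in> ?I" "X \<in> \<X>" for k X
    using pos_def_one_plus_gram[OF D_dim[OF that] D_pd[OF that] R_dim[OF that]] R_dim[OF that]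
    by (auto simp: Z_mat_def intro!: carrier_matI)
  have feasibleD: "\<Gamma> k \<in> carrier_mat (m k) (m k)"
      "1\<^sub>m (m k) + \<Gamma> k \<in> carrier_mat (m k) (m k) \<and> pos_def_mat (1\<^sub>m (m k) + \<Gamma> k)"
    if "\<Gamma> \<in> dual_feasible K m" "k \<in> ?I" for \<Gamma> k
    using PiE_mem[OF that[unfolded dual_feasible_def]] by auto
  \<comment> \<open>Stated for every \<open>X\<close>, since it is needed at \<open>X0\<close> to
    find the maximizer and at all other points to evaluate the objective there.\<close>
  have dual: "?f X \<Gamma> = (\<Sum>k = 1..K. \<omega> k * log_det_bound (1\<^sub>m (m k) + \<Gamma> k) (?Z k X))"
    if \<Gamma>: "\<Gamma> \<in> dual_feasible K m" and X: "X \<in> \<X>" for \<Gamma> X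
    unfolding dual_objective_def Z_mat_def
  proof (rule sum.cong[OF refl])
    fix k assume k: "k \<in> ?I"
    show "\<omega> k * (log_det (1\<^sub>m (m k) + \<Gamma> k) - Re (mat_trace (\<Gamma> k)) +
         Re (mat_trace ((1\<^sub>m (m k) + \<Gamma> k) * mat_adjoint (R k X) * mat_inv (C k X + D k X) * R k X))) =
       \<omega> k * log_det_bound (1\<^sub>m (m k) + \<Gamma> k)
         (1\<^sub>m (m k) + mat_adjoint (R k X) * mat_inv (D k X) * R k X)"
      using dual_term_eq[OF D_dim[OF k X] D_pd[OF k X] R_dim[OF k X] C_dim[OF k X] C_psd[OF k X]
          R_factor[OF k X] feasibleD(1)[OF \<Gamma> k]] by simp
  qed
  \<comment> \<open>The equality case of the bound demands \<open>1 + \<Gamma> = Z\<close>;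
    \<open>restrict\<close> makes the family extensional, as feasibility requires.\<close>
  define \<Gamma>0 where "\<Gamma>0 = restrict (\<lambda>k. ?Z k X0 - 1\<^sub>m (m k)) ?I"
  have \<Gamma>0: "1\<^sub>m (m k) + \<Gamma>0 k = ?Z k X0" if "k \<in> ?I" for k
    using Z[OF that X0] that by (simp add: \<Gamma>0_def one_add_diff_one)
  have \<Gamma>0_feasible: "\<Gamma>0 \<in> dual_feasible K m"
    unfolding dual_feasible_def
  proof (rule PiE_I)
    fix k assume k: "k \<in> ?I"
    have "hermitian_mat (\<Gamma>0 k)"
      using Z[OF k X0] k
      by (simp add: \<Gamma>0_def hermitian_mat_def mat_adjoint_diff[of _ "m k" "m k"]
          pos_def_matD(1)[of _ "m k"])
    then show "\<Gamma>0 k \<in> {G \<in> carrier_mat (m k) (m k).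
        hermitian_mat G \<and> pos_def_mat (1\<^sub>m (m k) + G)}"
      using Z[OF k X0] \<Gamma>0[OF k] k by (simp add: \<Gamma>0_def minus_carrier_mat)
  qed (auto simp: \<Gamma>0_def)
  have self: "log_det_bound (?Z k X0) (?Z k X0) = log_det (?Z k X0)" if "k \<in> ?I" for k
    using log_det_bound_self Z[OF that X0] by blast
  have f\<Gamma>0: "?f X0 \<Gamma>0 = (\<Sum>k = 1..K. \<omega> k * log_det (?Z k X0))"
    unfolding dual[OF \<Gamma>0_feasible X0] by (rule sum.cong[OF refl]) (use \<Gamma>0 self in simp)
  have f_le: "?f X0 \<Gamma> \<le> ?f X0 \<Gamma>0" if "\<Gamma> \<in> dual_feasible K m" for \<Gamma>
    unfolding f\<Gamma>0 dual[OF that X0]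
    using weighted_log_det_bound_le(1)[OF weights feasibleD(2)[OF that] Z[OF _ X0]] by simp
  \<comment> \<open>This equivalence gives existence and uniqueness at once and lets the maximizer
    be replaced by \<open>\<Gamma>0\<close> in the remaining claims.\<close>
  have arg_max: "is_arg_max (?f X0) (\<lambda>\<Gamma>. \<Gamma> \<in> dual_feasible K m) \<Gamma> \<longleftrightarrow> \<Gamma> = \<Gamma>0" for \<Gamma>
  proof
    assume "is_arg_max (?f X0) (\<lambda>\<Gamma>. \<Gamma> \<in> dual_feasible K m) \<Gamma>"
    then have \<Gamma>: "\<Gamma> \<in> dual_feasible K m" and "\<not> ?f X0 \<Gamma>0 > ?f X0 \<Gamma>"
      using \<Gamma>0_feasible by (auto simp: is_arg_max_def)
    then have eq: "?f X0 \<Gamma> = ?f X0 \<Gamma>0" using f_le[OF \<Gamma>] by simp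
    have "\<Gamma> k = \<Gamma>0 k" if k: "k \<in> ?I" for k
    proof -
      have "1\<^sub>m (m k) + \<Gamma> k = ?Z k X0"
        using weighted_log_det_bound_le(2)[OF weights feasibleD(2)[OF \<Gamma>] Z[OF _ X0] _ k] eq
        unfolding f\<Gamma>0 dual[OF \<Gamma> X0] by simp
      then show ?thesis
        using one_add_diff_one(2)[OF feasibleD(1)[OF \<Gamma> k]] k by (simp add: \<Gamma>0_def)
    qed
    \<comment> \<open>Both families are extensional, so agreement on the index set is
      enough.\<close>
    then show "\<Gamma> = \<Gamma>0"
      using \<Gamma> \<Gamma>0_feasible unfolding dual_feasible_def by (intro PiE_ext) auto
  next
    assume "\<Gamma> = \<Gamma>0"
    then show "is_arg_max (?f X0) (\<lambda>\<Gamma>. \<Gamma> \<in> dual_feasible K m) \<Gamma>"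
      using \<Gamma>0_feasible f_le by (auto simp: is_arg_max_def not_less)
  qed
  have value_at: "?f X \<Gamma>0 = (\<Sum>k = 1..K. \<omega> k * log_det_bound (?Z k X0) (?Z k X))" if "X \<in> \<X>" for X
    unfolding dual[OF \<Gamma>0_feasible that] by (rule sum.cong[OF refl]) (use \<Gamma>0 in simp)
  have "surrogate_at \<X> (original_objective K \<omega> m R D) X0
      (\<lambda>X. \<Sum>k = 1..K. \<omega> k * log_det_bound (?Z k X0) (?Z k X))"
    unfolding surrogate_at_def original_objective_def
    using weighted_log_det_bound_le(1)[OF weights Z[OF _ X0] Z] self by simp
  moreover have "log_det_bound Z' Z \<le> log_det Z \<and> log_det_bound Z Z = log_det Z"
    if "Z \<in> carrier_mat r r" "Z' \<in> carrier_mat r r" "pos_def_mat Z" "pos_def_mat Z'" for r Z Z'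
    using log_det_bound_le(1) log_det_bound_self that by blast
  ultimately show ?thesis
    unfolding arg_max using value_at Z by simp
qed

end
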